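(* Let $K$ be a field of characteristic $0$ and let $s(x)=\sum_{j=0}^{\infty}s_jx^j\in K[[x]]$ be a formal power series with $s_0\neq 0$. Let $(P_n(x))_{n\ge 1}$ be the polynomials defined recursively by $P_1(x)=s_0$ and $P_n(x)=\lfloor P_{n-1}(x)\,s(x)\rfloor_n$ for $n\ge 2$, and let $$q(t)=\sum_{n=1}^{\infty}\big([x^{n-1}]P_n(x)\big)\,t^n .$$ Then $$q(t)=t\,s(q(t)).$$
   Context: For a formal power series $f(x)=\sum_{j\ge 0}f_jx^j$ and a positive integer $k$, $\lfloor f(x)\rfloor_k=f_0+f_1x+\cdots+f_{k-1}x^{k-1}$ denotes its truncation to order $k-1$. The notation $[x^m]f(x)$ denotes the coefficient $f_m$. Thus $P_n(x)$ is a polynomial of degree at most $n-1$. *)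

theory Defs
  imports "HOL-Computational_Algebra.Polynomial_FPS"
begin

definition fps_trunc :: "nat \<Rightarrow> 'a::comm_monoid_add fps \<Rightarrow> 'a poly" where
  "fps_trunc k f = (\<Sum>j<k. monom (fps_nth f j) j)"

end

theory Submission
  imports Defs
begin

text \<open>
  Put \<open>M\<^sub>n = s\<^sup>n (1 - x s'/s)\<close>. Since \<open>M\<^sub>n = s\<^sup>n - x (s\<^sup>n)'/n\<close>, the coefficient of \<open>x\<^sup>n\<close> in \<open>M\<^sub>n\<close>
  vanishes for \<open>n \<ge> 1\<close>; this is why truncating loses nothing and \<open>P\<^sub>n\<close> is the truncation of \<open>M\<^sub>n\<close>.
  If \<open>Q\<close> is the solution of \<open>Q = t s(Q)\<close>, then both \<open>F \<mapsto> F(Q)\<close> and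
  \<open>F \<mapsto> \<Sum>\<^sub>n ([x\<^sup>n] F M\<^sub>n) t\<^sup>n\<close> satisfy \<open>\<Phi>(c + x G) = c + t \<Phi>(G s)\<close>, so they agree, and
  \<open>F = x\<close> gives \<open>Q = q\<close>.
\<close>

lemma coeff_fps_trunc: "coeff (fps_trunc k f) j = (if j < k then fps_nth f j else 0)"
  by (simp add: fps_trunc_def coeff_sum)

lemma fps_eq_const_plus_X_shift: "(F :: 'a::comm_semiring_1 fps) = fps_const (fps_nth F 0) + fps_X * fps_shift 1 F"
  by (rule fps_ext) (simp split: nat.split)

text \<open>The equation says that \<open>Q / s(Q)\<close> is the variable, so \<open>Q\<close> is
  the compositional inverse of \<open>x / s\<close>, which exists because the linear coefficient
  \<open>1 / s_0\<close> is nonzero.\<close>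

lemma fps_functional_equation_solvable:
  fixes s :: "'a::field fps"
  assumes "fps_nth s 0 \<noteq> 0"
  shows "\<exists>Q. fps_nth Q 0 = 0 \<and> Q = fps_X * (s oo Q)"
proof -
  define Q where "Q = fps_inv (fps_X * inverse s)"
  have Q0: "fps_nth Q 0 = 0" by (simp add: Q_def fps_inv_def)
  have "fps_X = (fps_X * inverse s) oo Q"
    unfolding Q_def using assms by (subst fps_inv_right) simp_all
  also have "\<dots> = Q * inverse (s oo Q)"
    using Q0 assms by (simp add: fps_compose_mult_distrib fps_inverse_compose fps_X_fps_compose_startby0)
  finally have "fps_X * (s oo Q) = Q * (inverse (s oo Q) * (s oo Q))"
    by (simp add: mult.assoc)
  also have "\<dots> = Q"
    using assms by (simp add: inverse_mult_eq_1)
  finally show ?thesis using Q0 by metis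
qed

definition lagrange_kernel :: "'a::field fps \<Rightarrow> nat \<Rightarrow> 'a fps" where
  "lagrange_kernel s n = s ^ n * (1 - fps_X * fps_deriv s * inverse s)"

lemma lagrange_kernel_Suc: "lagrange_kernel s (Suc n) = lagrange_kernel s n * s"
  by (simp add: lagrange_kernel_def mult_ac)

lemma nth_lagrange_kernel_diagonal:
  fixes s :: "'a::field_char_0 fps"
  assumes "fps_nth s 0 \<noteq> 0"
  shows "fps_nth (lagrange_kernel s (Suc n)) (Suc n) = 0"
proof -
  have "lagrange_kernel s (Suc n) = s ^ Suc n - fps_X * (fps_deriv s * s ^ n) * (inverse s * s)"
    by (simp add: lagrange_kernel_def algebra_simps)
  also have "\<dots> = s ^ Suc n - fps_X * (fps_deriv s * s ^ n)"
    using assms by (simp add: inverse_mult_eq_1)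
  \<comment> \<open>Scaling by \<open>Suc n\<close> avoids division; characteristic 0 allows
    cancelling it at the end.\<close>
  finally have "fps_const (of_nat (Suc n)) * lagrange_kernel s (Suc n)
      = fps_const (of_nat (Suc n)) * s ^ Suc n - fps_X * fps_deriv (s ^ Suc n)"
    by (simp only: fps_deriv_power diff_Suc_1) (simp only: algebra_simps)
  then have "of_nat (Suc n) * fps_nth (lagrange_kernel s (Suc n)) (Suc n) =
      of_nat (Suc n) * fps_nth (s ^ Suc n) (Suc n) - fps_nth (fps_X * fps_deriv (s ^ Suc n)) (Suc n)"
    by (metis fps_mult_left_const_nth fps_sub_nth)
  also have "\<dots> = 0"
    by (simp del: power_Suc of_nat_Suc)
  finally show ?thesis by (simp del: of_nat_Suc)
qed

text \<open>A form of Lagrange inversion. \<open>F\<close> is kept arbitrary because the induction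
  step passes from \<open>F = c + x G\<close> to \<open>G * s\<close>.\<close>

lemma nth_mult_lagrange_kernel:
  fixes s Q F :: "'a::field_char_0 fps"
  assumes s0: "fps_nth s 0 \<noteq> 0" and Q0: "fps_nth Q 0 = 0" and Q: "Q = fps_X * (s oo Q)"
  shows "fps_nth (F * lagrange_kernel s n) n = fps_nth (F oo Q) n"
proof (induction n arbitrary: F)
  case 0
  show ?case by (simp add: lagrange_kernel_def)
next
  case (Suc n)
  define G where "G = fps_shift 1 F"
  define c where "c = fps_const (fps_nth F 0)"
  have F: "F = c + fps_X * G"
    unfolding G_def c_def by (rule fps_eq_const_plus_X_shift)
  have "F oo Q = c + fps_X * ((G * s) oo Q)"
  proof -
    have "F oo Q = c + Q * (G oo Q)"
      using Q0 by (subst F) (simp add: fps_compose_add_distrib fps_compose_mult_distrib c_def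
          fps_X_fps_compose_startby0)
    also have "Q * (G oo Q) = fps_X * (s oo Q) * (G oo Q)"
      by (rule arg_cong [OF Q, of "\<lambda>h. h * (G oo Q)"])
    also have "\<dots> = fps_X * ((G * s) oo Q)"
      using Q0 by (simp add: fps_compose_mult_distrib mult_ac)
    finally show ?thesis .
  qed
  then have "fps_nth (F oo Q) (Suc n) = fps_nth ((G * s) oo Q) n"
    by (simp add: c_def)
  also have "\<dots> = fps_nth (G * s * lagrange_kernel s n) n"
    by (rule Suc.IH [symmetric])
  also have "\<dots> = fps_nth (F * lagrange_kernel s (Suc n)) (Suc n)"
  proof -
    have "F * lagrange_kernel s (Suc n)
        = c * lagrange_kernel s (Suc n) + fps_X * (G * s * lagrange_kernel s n)"
      by (subst F) (simp add: lagrange_kernel_Suc algebra_simps)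
    \<comment> \<open>The constant \<open>c\<close> only multiplies the vanishing diagonal
      coefficient.\<close>
    then show ?thesis
      using nth_lagrange_kernel_diagonal [OF s0, of n] by (simp add: c_def)
  qed
  finally show ?case by (rule sym)
qed

lemma iterated_trunc_eq_trunc_lagrange_kernel:
  fixes s :: "'a::field_char_0 fps" and P :: "nat \<Rightarrow> 'a poly"
  assumes s0: "fps_nth s 0 \<noteq> 0" and P1: "P 1 = [:fps_nth s 0:]"
    and P_step: "\<And>n. n \<ge> 2 \<Longrightarrow> P n = fps_trunc n (fps_of_poly (P (n - 1)) * s)"
  shows "P (Suc n) = fps_trunc (Suc n) (lagrange_kernel s (Suc n))"
proof (induction n)
  case 0
  show ?case
    using P1 by (simp add: fps_trunc_def lagrange_kernel_def monom_0)
next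
  case (Suc n)
  \<comment> \<open>The next truncation needs one degree more than the induction hypothesis keeps;
    at \<open>i = Suc n\<close> both sides are 0.\<close>
  have agree: "coeff (P (Suc n)) i = fps_nth (lagrange_kernel s (Suc n)) i" if "i \<le> Suc n" for i
    using that nth_lagrange_kernel_diagonal [OF s0, of n]
    by (cases "i = Suc n") (simp_all add: Suc.IH coeff_fps_trunc)
  have "P (Suc (Suc n)) = fps_trunc (Suc (Suc n)) (fps_of_poly (P (Suc n)) * s)"
    using P_step [of "Suc (Suc n)"] by simp
  also have "\<dots> = fps_trunc (Suc (Suc n)) (lagrange_kernel s (Suc n) * s)"
    by (rule poly_eqI) (simp add: coeff_fps_trunc fps_mult_nth agree)
  finally show ?case by (simp only: lagrange_kernel_Suc)
qed

theorem mainTheorem1: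
  fixes s q :: "'a::field_char_0 fps"
    and P :: "nat \<Rightarrow> 'a poly"
  assumes "fps_nth s 0 \<noteq> 0"
    and "P 1 = [:fps_nth s 0:]"
    and "\<And>n. n \<ge> 2 \<Longrightarrow> P n = fps_trunc n (fps_of_poly (P (n - 1)) * s)"
    and "q = Abs_fps (\<lambda>n. if n = 0 then 0 else coeff (P n) (n - 1))"
  shows "q = fps_X * (s oo q)"
proof -
  obtain Q where Q0: "fps_nth Q 0 = 0" and Q: "Q = fps_X * (s oo Q)"
    using fps_functional_equation_solvable [OF assms(1)] by blast
  have "q = Q"
  proof (rule fps_ext)
    fix n
    show "fps_nth q n = fps_nth Q n"
    proof (cases n)
      case 0
      then show ?thesis using Q0 assms(4) by simp
    next
      case (Suc m)
      \<comment> \<open>The factor \<open>fps_X\<close> shifts the index to \<open>n - 1\<close>,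
        the top degree that survives in \<open>P n\<close>.\<close>
      have "fps_nth q n = fps_nth (fps_X * lagrange_kernel s n) n"
        using iterated_trunc_eq_trunc_lagrange_kernel [OF assms(1-3), of m]
        by (simp add: assms(4) Suc coeff_fps_trunc)
      also have "\<dots> = fps_nth Q n"
        using nth_mult_lagrange_kernel [OF assms(1) Q0 Q, of fps_X n] Q0
        by (simp add: fps_X_fps_compose_startby0)
      finally show ?thesis .
    qed
  qed
  show ?thesis unfolding \<open>q = Q\<close> by (rule Q)
qed

end
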